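(* Let $d>2$ be an integer, let $\mathcal{A}\subset\mathbb{R}^d$ be compact, and let $\mathcal{S}$ be a Steiner tree for $\mathcal{A}$ with $\mathcal{H}^1(\mathcal{S})<\infty$. Assume that for some $s>0$ and some $x\in\mathbb{R}^d$ the open ball $B_s(x)$ has empty intersection with $\mathcal{A}$, and let $\rho\in(0,1)$. Then \[ \frac{\mathcal{H}^1(\mathcal{S}\cap B_{\rho s}(x))}{s}\le\left(\frac{144d}{1-\rho}\right)^{d-2}. \]
   Context: $\mathcal{H}^1$ is the one-dimensional Hausdorff measure on $\mathbb{R}^d$ and $B_r(x)$ is the open Euclidean ball of radius $r$ centered at $x$. For $\mathcal{A}\subset\mathbb{R}^d$ compact, a closed set $\mathcal{S}\subset\mathbb{R}^d$ is a Steiner set for $\mathcal{A}$ if $\mathcal{S}\cup\mathcal{A}$ is connected and $\mathcal{H}^1(\mathcal{S})\le\mathcal{H}^1(S)$ for every $S\subset\mathbb{R}^d$ such that $S\cup\mathcal{A}$ is connected. A Steiner tree for $\mathcal{A}$ is a Steiner set for $\mathcal{A}$ that is itself connected. *)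

theory Defs
  imports "HOL-Analysis.Analysis"
begin

text \<open>
  One-dimensional Hausdorff (outer) measure, normalised so that a unit segment has measure 1.
  Covers are by arbitrary sets; finite covers are included, since \<^term>\<open>C i\<close> may be empty
  and \<^prop>\<open>diameter {} = 0\<close>. Boundedness is required explicitly because \<^const>\<open>diameter\<close>
  is real-valued and carries no information on unbounded sets.
\<close>

definition hausdorff1_delta :: "real \<Rightarrow> 'a::metric_space set \<Rightarrow> ennreal" where
  "hausdorff1_delta \<delta> S =
     (INF C \<in> {C :: nat \<Rightarrow> 'a set. (\<forall>i. bounded (C i) \<and> diameter (C i) \<le> \<delta>) \<and> S \<subseteq> (\<Union>i. C i)}.
        \<Sum>i. ennreal (diameter (C i)))"

definition hausdorff1 :: "'a::metric_space set \<Rightarrow> ennreal" where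
  "hausdorff1 S = (SUP \<delta> \<in> {0<..}. hausdorff1_delta \<delta> S)"

text \<open>The competitors \<^term>\<open>T\<close> are arbitrary subsets, not assumed closed or measurable.\<close>

definition steiner_set :: "'a::metric_space set \<Rightarrow> 'a set \<Rightarrow> bool" where
  "steiner_set A S \<longleftrightarrow>
     closed S \<and> connected (S \<union> A) \<and>
     (\<forall>T. connected (T \<union> A) \<longrightarrow> hausdorff1 S \<le> hausdorff1 T)"

definition steiner_tree :: "'a::metric_space set \<Rightarrow> 'a set \<Rightarrow> bool" where
  "steiner_tree A S \<longleftrightarrow> steiner_set A S \<and> connected S"

end

theory Submission
  imports Defs
begin

text \<open>
  Let \<open>f r\<close> be the measure of \<open>S\<close> in the ball of radius \<open>r\<close> and \<open>m = d - 2\<close>. Replacing the part of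
  \<open>S\<close> inside the ball by a connected set through the \<open>N\<close> points of \<open>S\<close> on the sphere gives a
  competitor. Among \<open>N\<close> points on a \<open>(d - 1)\<close>-dimensional sphere of radius \<open>r\<close> two are at distance
  \<open>O(r N^(-1/(d-1)))\<close>, by a volume comparison, so such a set has length \<open>O(r N^(m/(m+1)))\<close>. On the
  other hand some radius between \<open>a\<close> and \<open>b\<close> has \<open>N \<le> (f b - f a) / (b - a)\<close>. Hence
  \<open>f a ^ (m+1) (b - a) ^ m \<le> D s ^ (m+1) (f b - f a) ^ m\<close>, and a function satisfying this
  doubles too fast to stay finite up to \<open>s\<close> unless \<open>f (\<rho> s)\<close> obeys the claimed bound.
\<close>

section \<open>One-dimensional Hausdorff measure: monotonicity, subadditivity, additivity at
  positive distance, segments\<close>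

lemma hausdorff1_delta_le:
  assumes "\<And>i. bounded (C i)" "\<And>i. diameter (C i) \<le> \<delta>" "S \<subseteq> (\<Union>i. C i)"
  shows "hausdorff1_delta \<delta> S \<le> (\<Sum>i. ennreal (diameter (C i)))"
  unfolding hausdorff1_delta_def using assms by (intro INF_lower) auto

lemma hausdorff1_delta_cover:
  assumes "hausdorff1_delta \<delta> S < c"
  obtains C where "\<And>i. bounded (C i)" "\<And>i. diameter (C i) \<le> \<delta>" "S \<subseteq> (\<Union>i. C i)"
    "(\<Sum>i. ennreal (diameter (C i))) < c"
  using assms unfolding hausdorff1_delta_def by (auto simp: INF_less_iff)

lemma hausdorff1_delta_mono: "S \<subseteq> T \<Longrightarrow> hausdorff1_delta \<delta> S \<le> hausdorff1_delta \<delta> T"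
  unfolding hausdorff1_delta_def by (intro INF_superset_mono) auto

lemma hausdorff1_delta_antimono: "\<delta> \<le> \<epsilon> \<Longrightarrow> hausdorff1_delta \<epsilon> S \<le> hausdorff1_delta \<delta> S"
  unfolding hausdorff1_delta_def by (rule INF_superset_mono) (auto intro: order_trans)

lemma hausdorff1_delta_le_hausdorff1: "0 < \<delta> \<Longrightarrow> hausdorff1_delta \<delta> S \<le> hausdorff1 S"
  unfolding hausdorff1_def by (intro SUP_upper) auto

lemma hausdorff1_mono: "S \<subseteq> T \<Longrightarrow> hausdorff1 S \<le> hausdorff1 T"
  unfolding hausdorff1_def by (intro SUP_mono) (auto intro: hausdorff1_delta_mono)

lemma hausdorff1_empty [simp]: "hausdorff1 {} = 0"
proof -
  have "hausdorff1_delta \<delta> {} = 0" if "\<delta> > 0" for \<delta> :: real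
    using hausdorff1_delta_le[of "\<lambda>_. {}" \<delta> "{}"] that by (simp add: diameter_empty)
  then have "hausdorff1 ({} :: 'a set) \<le> 0"
    unfolding hausdorff1_def by (intro SUP_least) auto
  then show ?thesis by simp
qed

lemma hausdorff1_delta_Un:
  "hausdorff1_delta \<delta> (S \<union> T) \<le> hausdorff1_delta \<delta> S + hausdorff1_delta \<delta> T"
proof (rule ennreal_le_epsilon)
  fix e :: real assume fin: "hausdorff1_delta \<delta> S + hausdorff1_delta \<delta> T < top" and "0 < e"
  have lt: "hausdorff1_delta \<delta> S < hausdorff1_delta \<delta> S + ennreal (e/2)"
    "hausdorff1_delta \<delta> T < hausdorff1_delta \<delta> T + ennreal (e/2)"
    using fin \<open>0 < e\<close> by (auto simp: ennreal_add_left_cancel_less less_top add_top)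
  obtain C where C: "\<And>i. bounded (C i)" "\<And>i. diameter (C i) \<le> \<delta>" "S \<subseteq> (\<Union>i. C i)"
    "(\<Sum>i. ennreal (diameter (C i))) < hausdorff1_delta \<delta> S + ennreal (e/2)"
    using hausdorff1_delta_cover[OF lt(1)] by metis
  obtain D where D: "\<And>i. bounded (D i)" "\<And>i. diameter (D i) \<le> \<delta>" "T \<subseteq> (\<Union>i. D i)"
    "(\<Sum>i. ennreal (diameter (D i))) < hausdorff1_delta \<delta> T + ennreal (e/2)"
    using hausdorff1_delta_cover[OF lt(2)] by metis
  have "0 \<le> \<delta>" using C(1,2)[of 0] diameter_ge_0 order_trans by blast
  \<comment> \<open>The two covers become rows 0 and 1 of a double sequence, which
    \<open>prod_decode\<close> enumerates as one cover. The empty padding respects the diameter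
    bound because \<open>0 \<le> \<delta>\<close>.\<close>
  define G where "G = (\<lambda>m n. if m = 0 then C n else if m = Suc 0 then D n else {})"
  define h where "h = (\<lambda>(m::nat,n::nat). G m n)"
  have hb: "bounded (h p)" "diameter (h p) \<le> \<delta>" for p
    using C D \<open>0 \<le> \<delta>\<close> by (auto simp: h_def G_def split: prod.splits)
  have "hausdorff1_delta \<delta> (S \<union> T) \<le> (\<Sum>i. ennreal (diameter (h (prod_decode i))))"
  proof (rule hausdorff1_delta_le[where C = "\<lambda>i. h (prod_decode i)"])
    show "S \<union> T \<subseteq> (\<Union>i. h (prod_decode i))"
    proof
      fix p assume "p \<in> S \<union> T"
      then obtain m n where "p \<in> G m n"
      proof
        assume "p \<in> S"
        with C(3) obtain n where "p \<in> C n" by auto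
        then show ?thesis using that[of 0 n] by (simp add: G_def)
      next
        assume "p \<in> T"
        with D(3) obtain n where "p \<in> D n" by auto
        then show ?thesis using that[of "Suc 0" n] by (simp add: G_def)
      qed
      then have "p \<in> h (prod_decode (prod_encode (m,n)))" by (simp add: h_def)
      then show "p \<in> (\<Union>i. h (prod_decode i))" by blast
    qed
  qed (use hb in auto)
  also have "\<dots> = (\<Sum>m. \<Sum>n. ennreal (diameter (G m n)))"
    by (rule suminf_ennreal_2dimen[where f = "\<lambda>p. ennreal (diameter (h p))", unfolded o_def])
      (auto simp: h_def)
  also have "\<dots> = (\<Sum>m\<in>{0,Suc 0}. \<Sum>n. ennreal (diameter (G m n)))"
    by (rule suminf_finite) (auto simp: G_def)
  also have "\<dots> = (\<Sum>n. ennreal (diameter (C n))) + (\<Sum>n. ennreal (diameter (D n)))"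
    by (simp add: G_def)
  also have "\<dots> \<le> (hausdorff1_delta \<delta> S + ennreal (e/2)) + (hausdorff1_delta \<delta> T + ennreal (e/2))"
    using C(4) D(4) by (intro add_mono) auto
  also have "\<dots> = hausdorff1_delta \<delta> S + hausdorff1_delta \<delta> T + (ennreal (e/2) + ennreal (e/2))"
    by (simp add: ac_simps)
  also have "ennreal (e/2) + ennreal (e/2) = ennreal e"
    using \<open>0 < e\<close> by (simp flip: ennreal_plus)
  finally show "hausdorff1_delta \<delta> (S \<union> T)
      \<le> hausdorff1_delta \<delta> S + hausdorff1_delta \<delta> T + ennreal e" .
qed

lemma hausdorff1_Un: "hausdorff1 (S \<union> T) \<le> hausdorff1 S + hausdorff1 T"
  unfolding hausdorff1_def[of "S \<union> T"]
proof (rule SUP_least)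
  fix \<delta> :: real assume "\<delta> \<in> {0<..}"
  then show "hausdorff1_delta \<delta> (S \<union> T) \<le> hausdorff1 S + hausdorff1 T"
    by (intro order_trans[OF hausdorff1_delta_Un] add_mono hausdorff1_delta_le_hausdorff1) auto
qed

text \<open>A set of diameter at most \<open>\<delta>\<close> cannot meet both \<open>S\<close> and
  \<open>T\<close>, so every cover of the union splits into a cover of \<open>S\<close> and a cover
  of \<open>T\<close> that share no nonempty set.\<close>

lemma hausdorff1_delta_separated:
  assumes "\<delta> < e" and sep: "\<And>p q. p \<in> S \<Longrightarrow> q \<in> T \<Longrightarrow> e \<le> dist p q"
  shows "hausdorff1_delta \<delta> S + hausdorff1_delta \<delta> T \<le> hausdorff1_delta \<delta> (S \<union> T)"
  unfolding hausdorff1_delta_def[of \<delta> "S \<union> T"]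
proof (rule INF_greatest)
  fix C assume "C \<in> {C. (\<forall>i::nat. bounded (C i) \<and> diameter (C i) \<le> \<delta>) \<and> S \<union> T \<subseteq> (\<Union>i. C i)}"
  then have C: "\<And>i. bounded (C i)" "\<And>i. diameter (C i) \<le> \<delta>" "S \<union> T \<subseteq> (\<Union>i. C i)" by auto
  have "0 \<le> \<delta>" using C(1,2)[of 0] diameter_ge_0 order_trans by blast
  define D where "D = (\<lambda>i. if C i \<inter> S = {} then {} else C i)"
  define E where "E = (\<lambda>i. if C i \<inter> S = {} then C i else {})"
  have "hausdorff1_delta \<delta> S \<le> (\<Sum>i. ennreal (diameter (D i)))"
    using C \<open>0 \<le> \<delta>\<close> by (intro hausdorff1_delta_le) (auto simp: D_def subset_iff, blast)
  moreover have "hausdorff1_delta \<delta> T \<le> (\<Sum>i. ennreal (diameter (E i)))"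
  proof (rule hausdorff1_delta_le)
    show "T \<subseteq> (\<Union>i. E i)"
    proof
      fix q assume "q \<in> T"
      with C(3) obtain i where i: "q \<in> C i" by auto
      have "C i \<inter> S = {}"
      proof (rule ccontr)
        assume "C i \<inter> S \<noteq> {}"
        then obtain p where p: "p \<in> C i" "p \<in> S" by auto
        have "dist p q \<le> diameter (C i)"
          using C(1) p(1) i by (rule diameter_bounded_bound)
        with sep[OF p(2) \<open>q \<in> T\<close>] C(2)[of i] \<open>\<delta> < e\<close> show False by linarith
      qed
      with i show "q \<in> (\<Union>i. E i)" by (auto simp: E_def)
    qed
  qed (use C \<open>0 \<le> \<delta>\<close> in \<open>auto simp: E_def\<close>)
  ultimately have "hausdorff1_delta \<delta> S + hausdorff1_delta \<delta> T
      \<le> (\<Sum>i. ennreal (diameter (D i))) + (\<Sum>i. ennreal (diameter (E i)))"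
    by (rule add_mono)
  also have "\<dots> = (\<Sum>i. ennreal (diameter (D i)) + ennreal (diameter (E i)))"
    by (rule suminf_add) auto
  also have "\<dots> = (\<Sum>i. ennreal (diameter (C i)))"
    by (rule suminf_cong) (auto simp: D_def E_def)
  finally show "hausdorff1_delta \<delta> S + hausdorff1_delta \<delta> T \<le> (\<Sum>i. ennreal (diameter (C i)))" .
qed

text \<open>Since \<open>hausdorff1_delta\<close> is antitone in \<open>\<delta>\<close>, the
  supremum is a limit along a sequence. In this form inequalities between sums pass to
  \<open>hausdorff1\<close>.\<close>

lemma hausdorff1_LIMSEQ: "(\<lambda>n. hausdorff1_delta (1 / Suc n) S) \<longlonglongrightarrow> hausdorff1 S"
proof -
  have "hausdorff1 S = (SUP n. hausdorff1_delta (1 / Suc n) S)"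
  proof (rule antisym)
    show "hausdorff1 S \<le> (SUP n. hausdorff1_delta (1 / Suc n) S)"
      unfolding hausdorff1_def
    proof (rule SUP_least)
      fix \<delta> :: real assume "\<delta> \<in> {0<..}"
      then obtain n where "1 / real (Suc n) < \<delta>" using nat_approx_posE by auto
      then show "hausdorff1_delta \<delta> S \<le> (SUP n. hausdorff1_delta (1 / Suc n) S)"
        by (intro SUP_upper2[of n] hausdorff1_delta_antimono) auto
    qed
  qed (auto intro!: SUP_least hausdorff1_delta_le_hausdorff1)
  moreover have "incseq (\<lambda>n. hausdorff1_delta (1 / Suc n) S)"
    by (intro incseq_SucI hausdorff1_delta_antimono) (simp add: field_simps)
  ultimately show ?thesis by (simp add: LIMSEQ_SUP)
qed

lemma hausdorff1_separated:
  assumes "0 < e" and sep: "\<And>p q. p \<in> S \<Longrightarrow> q \<in> T \<Longrightarrow> e \<le> dist p q"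
  shows "hausdorff1 S + hausdorff1 T \<le> hausdorff1 (S \<union> T)"
proof -
  obtain N where N: "1 / real (Suc N) < e" using nat_approx_posE[OF \<open>0 < e\<close>] by auto
  have "eventually (\<lambda>n. hausdorff1_delta (1 / Suc n) S + hausdorff1_delta (1 / Suc n) T
      \<le> hausdorff1_delta (1 / Suc n) (S \<union> T)) sequentially"
  proof (rule eventually_sequentiallyI[of N])
    fix n assume "N \<le> n"
    then have "1 / real (Suc n) \<le> 1 / real (Suc N)" by (simp add: field_simps)
    with N have "1 / real (Suc n) < e" by linarith
    then show "hausdorff1_delta (1 / Suc n) S + hausdorff1_delta (1 / Suc n) T
      \<le> hausdorff1_delta (1 / Suc n) (S \<union> T)" using sep by (rule hausdorff1_delta_separated)
  qed
  then show ?thesis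
    by (intro tendsto_le[OF _ hausdorff1_LIMSEQ tendsto_add[OF hausdorff1_LIMSEQ hausdorff1_LIMSEQ]])
      auto
qed

text \<open>Cutting the segment into \<open>n\<close> equal pieces makes the diameters as small as
  desired while their sum stays at most the length.\<close>

lemma hausdorff1_closed_segment:
  fixes a b :: "'a::real_normed_vector"
  shows "hausdorff1 (closed_segment a b) \<le> ennreal (dist a b)"
  unfolding hausdorff1_def
proof (rule SUP_least)
  fix \<delta> :: real assume "\<delta> \<in> {0<..}"
  then have "0 < \<delta>" by simp
  obtain n :: nat where n: "dist a b / \<delta> < real n" using reals_Archimedean2 by blast
  have "0 \<le> dist a b / \<delta>" using \<open>0 < \<delta>\<close> by simp
  with n have "0 < real n" by linarith
  define \<gamma> where "\<gamma> = (\<lambda>t::real. a + t *\<^sub>R (b - a))"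
  define C where "C = (\<lambda>i. if i < n then \<gamma> ` {real i / n..real (Suc i) / n} else {})"
  have dist\<gamma>: "dist (\<gamma> s) (\<gamma> t) = \<bar>s - t\<bar> * dist a b" for s t
  proof -
    have "\<gamma> s - \<gamma> t = (s - t) *\<^sub>R (b - a)" by (simp add: \<gamma>_def algebra_simps)
    then show ?thesis by (simp add: dist_norm norm_minus_commute)
  qed
  have close: "dist p q \<le> dist a b / n" if "p \<in> C i" "q \<in> C i" for p q i
  proof -
    have "i < n" "p \<in> \<gamma> ` {real i / n..real (Suc i) / n}" "q \<in> \<gamma> ` {real i / n..real (Suc i) / n}"
      using that by (simp_all add: C_def split: if_splits)
    then obtain s t where st: "p = \<gamma> s" "q = \<gamma> t" "s \<in> {real i / n..real (Suc i) / n}"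
      "t \<in> {real i / n..real (Suc i) / n}" "i < n"
      by blast
    then have "\<bar>s - t\<bar> \<le> real (Suc i) / n - real i / n" by auto
    also have "\<dots> = 1 / n" by (simp add: diff_divide_distrib[symmetric])
    finally show ?thesis using mult_right_mono[of "\<bar>s - t\<bar>" "1 / n" "dist a b"]
      by (simp add: st dist\<gamma>)
  qed
  have bd: "bounded (C i)" for i
  proof (cases "C i = {}")
    case False
    then obtain p where "p \<in> C i" by auto
    then show ?thesis using close[OF \<open>p \<in> C i\<close>] unfolding bounded_def by blast
  qed simp
  have dC: "diameter (C i) \<le> dist a b / n" for i
    using close by (intro diameter_le) (auto simp: dist_norm)
  have "dist a b / n < \<delta>" using n \<open>0 < \<delta>\<close> \<open>0 < real n\<close> by (simp add: field_simps)
  have "hausdorff1_delta \<delta> (closed_segment a b) \<le> (\<Sum>i. ennreal (diameter (C i)))"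
  proof (rule hausdorff1_delta_le)
    show "diameter (C i) \<le> \<delta>" for i using dC[of i] \<open>dist a b / n < \<delta>\<close> by linarith
    show "closed_segment a b \<subseteq> (\<Union>i. C i)"
    proof
      fix p assume "p \<in> closed_segment a b"
      then obtain t where t: "p = \<gamma> t" "0 \<le> t" "t \<le> 1"
        by (auto simp: closed_segment_def \<gamma>_def algebra_simps)
      have "\<exists>i<n. real i / n \<le> t \<and> t \<le> real (Suc i) / n"
      \<comment> \<open>At \<open>t = 1\<close> the floor used below would give index
        \<open>n\<close>, but the last piece has index \<open>n - 1\<close>.\<close>
      proof (cases "t = 1")
        case True
        with \<open>0 < real n\<close> show ?thesis by (intro exI[of _ "n - 1"]) (auto simp: field_simps)
      next
        case False
        define i where "i = nat \<lfloor>t * n\<rfloor>"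
        have "0 \<le> t * n" using t by simp
        then have i: "real i \<le> t * n" "t * n < real (Suc i)" unfolding i_def by linarith+
        have "t * n < n" using False t \<open>0 < real n\<close> by simp
        then have "i < n" using i by (metis le_less_trans of_nat_less_iff)
        then show ?thesis using i \<open>0 < real n\<close> by (intro exI[of _ i]) (auto simp: field_simps)
      qed
      then show "p \<in> (\<Union>i. C i)" by (auto simp: C_def t)
    qed
  qed (rule bd)
  also have "\<dots> = (\<Sum>i<n. ennreal (diameter (C i)))"
    by (rule suminf_finite) (auto simp: C_def)
  also have "\<dots> \<le> (\<Sum>i<n. ennreal (dist a b / n))"
    by (intro sum_mono ennreal_leI dC)
  also have "\<dots> = ennreal (dist a b)"
    using \<open>0 < real n\<close> by (simp add: ennreal_of_nat_eq_real_of_nat ennreal_mult[symmetric])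
  finally show "hausdorff1_delta \<delta> (closed_segment a b) \<le> ennreal (dist a b)" .
qed

section \<open>Replacing the part of a connected set inside a ball\<close>

text \<open>Suppose \<open>U\<close>, \<open>V\<close> separate the new set. By connectedness
  \<open>T\<close> lies on one side, say in \<open>U\<close>. Adding the open ball to
  \<open>U\<close> and removing the closed ball from \<open>V\<close> then separates
  \<open>X\<close>: points of \<open>X\<close> on the sphere lie in \<open>T\<close>, so
  \<open>V\<close> loses no point of the new set.\<close>

lemma connected_replace_ball:
  fixes X :: "'a::metric_space set"
  assumes "connected X" "connected T" "X \<inter> sphere x r \<subseteq> T" "X \<inter> ball x r \<noteq> {}"
  shows "connected (X - ball x r \<union> T)"
proof -
  define Y where "Y = X - ball x r \<union> T"
  have *: False
    if op: "open U" "open V" and cov: "Y \<subseteq> U \<union> V" and dis: "U \<inter> V \<inter> Y = {}"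
      and ne: "V \<inter> Y \<noteq> {}" and T: "V \<inter> T = {}" for U V
  proof -
    define U' where "U' = U \<union> ball x r"
    define V' where "V' = V - cball x r"
    have "open U'" "open V'" using op by (auto simp: U'_def V'_def open_Diff)
    moreover have VX: "V \<inter> Y \<subseteq> V' \<inter> X"
      using T assms(3) by (auto simp: V'_def Y_def sphere_def)
    moreover have "X \<subseteq> U' \<union> V'"
      using cov T assms(3) by (auto simp: U'_def V'_def Y_def subset_iff sphere_def)
    moreover have "U' \<inter> V' \<inter> X = {}"
      using dis by (auto simp: U'_def V'_def Y_def)
    moreover have "U' \<inter> X \<noteq> {}" using assms(4) by (auto simp: U'_def)
    ultimately show False using assms(1) ne unfolding connected_def by blast
  qed
  have "connected Y"
    unfolding connected_def
  proof
    assume "\<exists>U V. open U \<and> open V \<and> Y \<subseteq> U \<union> V \<and> U \<inter> V \<inter> Y = {} \<and> U \<inter> Y \<noteq> {} \<and> V \<inter> Y \<noteq> {}"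
    then obtain U V where UV: "open U" "open V" "Y \<subseteq> U \<union> V" "U \<inter> V \<inter> Y = {}"
      "U \<inter> Y \<noteq> {}" "V \<inter> Y \<noteq> {}" by blast
    have "U \<inter> T = {} \<or> V \<inter> T = {}"
      using assms(2) UV unfolding connected_def Y_def by blast
    then show False using *[of U V] *[of V U] UV by (auto simp: Un_commute Int_commute)
  qed
  then show ?thesis by (simp add: Y_def)
qed

section \<open>Length of a set bounded below by the number of points in its slices\<close>

text \<open>
  Eilenberg's inequality in contrapositive form. Each cover by sets of small diameter gives
  intervals containing their images under \<^term>\<open>f\<close>, whose multiplicity at \<^term>\<open>r\<close> eventually
  exceeds \<^term>\<open>k\<close>; Fatou's lemma then bounds the integral of the multiplicity. No measurability of
  \<^term>\<open>E\<close> is needed.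
\<close>

lemma hausdorff1_slices:
  fixes f :: "'a::metric_space \<Rightarrow> real" and k :: nat
  assumes lip: "\<And>p q. \<bar>f p - f q\<bar> \<le> dist p q" and "a < b"
    and many: "\<And>r. a < r \<Longrightarrow> r < b \<Longrightarrow> \<exists>P. P \<subseteq> E \<inter> f -` {r} \<and> finite P \<and> card P = k"
  shows "ennreal (real k * (b - a)) \<le> hausdorff1 E"
proof (cases "hausdorff1 E = top")
  case False
  have "\<exists>C. (\<forall>i. bounded (C i)) \<and> (\<forall>i. diameter (C i) \<le> 1 / Suc n) \<and> E \<subseteq> (\<Union>i. C i) \<and>
      (\<Sum>i. ennreal (diameter (C i))) < hausdorff1 E + ennreal (1 / Suc n)" for n
  proof -
    have "hausdorff1_delta (1 / Suc n) E \<le> hausdorff1 E"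
      by (rule hausdorff1_delta_le_hausdorff1) auto
    also have "\<dots> < hausdorff1 E + ennreal (1 / Suc n)"
      using False by (simp add: ennreal_add_left_cancel_less less_top)
    finally show ?thesis using hausdorff1_delta_cover by metis
  qed
  then obtain C where C: "\<And>n i. bounded (C n i)" "\<And>n i. diameter (C n i) \<le> 1 / Suc n"
    "\<And>n. E \<subseteq> (\<Union>i. C n i)"
    "\<And>n. (\<Sum>i. ennreal (diameter (C n i))) < hausdorff1 E + ennreal (1 / Suc n)"
    by metis
  \<comment> \<open>The closed hull is measurable even when the image of \<open>C n i\<close> is
    not, and \<open>f\<close> being 1-Lipschitz keeps its length below the diameter. Empty sets are
    treated apart because \<open>Inf\<close> and \<open>Sup\<close> of an empty set of reals carry
    no information.\<close>
  define I where "I = (\<lambda>n i. if C n i = {} then {} else {Inf (f ` C n i)..Sup (f ` C n i)})"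
  have le_diam: "f p \<le> f q + diameter (C n i)" if "p \<in> C n i" "q \<in> C n i" for p q n i
    using lip[of p q] diameter_bounded_bound[OF C(1) that] by linarith
  have bdd: "bdd_above (f ` C n i)" "bdd_below (f ` C n i)" if "p \<in> C n i" for p n i
    using le_diam that by (auto intro!: bdd_aboveI2[where M = "f p + diameter (C n i)"]
        bdd_belowI2[where m = "f p - diameter (C n i)"] simp: algebra_simps)
  have memI: "f p \<in> I n i" if "p \<in> C n i" for p n i
    using that bdd[OF that] by (auto simp: I_def intro: cINF_lower cSUP_upper)
  have I_le: "emeasure lborel (I n i) \<le> ennreal (diameter (C n i))" for n i
  proof (cases "C n i = {}")
    case False
    have "Sup (f ` C n i) - diameter (C n i) \<le> Inf (f ` C n i)"
    proof (rule cINF_greatest[OF False])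
      fix q assume q: "q \<in> C n i"
      have "Sup (f ` C n i) \<le> f q + diameter (C n i)"
        using le_diam q by (intro cSUP_least[OF False]) auto
      then show "Sup (f ` C n i) - diameter (C n i) \<le> f q" by linarith
    qed
    moreover have "Inf (f ` C n i) \<le> Sup (f ` C n i)"
      using False bdd by (meson all_not_in_conv cINF_lower cSUP_upper order_trans)
    ultimately show ?thesis using False by (auto simp: I_def intro: ennreal_leI)
  qed (simp add: I_def)
  define \<phi> where "\<phi> = (\<lambda>n r. \<Sum>i. indicator (I n i) r :: ennreal)"
  have I_meas: "I n i \<in> sets lborel" for n i by (auto simp: I_def)
  have \<phi>_meas: "\<phi> n \<in> borel_measurable lborel" for n
    unfolding \<phi>_def using I_meas by measurable
  have \<phi>_int: "(\<integral>\<^sup>+ r. \<phi> n r \<partial>lborel) \<le> hausdorff1 E + ennreal (1 / Suc n)" for n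
  proof -
    have "(\<integral>\<^sup>+ r. \<phi> n r \<partial>lborel) = (\<Sum>i. emeasure lborel (I n i))"
      unfolding \<phi>_def using I_meas by (subst nn_integral_suminf) auto
    also have "\<dots> \<le> (\<Sum>i. ennreal (diameter (C n i)))"
      by (intro suminf_le I_le) auto
    finally show ?thesis using C(4)[of n] by auto
  qed
  have \<phi>_ge: "of_nat k * indicator {a<..<b} r \<le> liminf (\<lambda>n. \<phi> n r)" for r
  proof (cases "r \<in> {a<..<b}")
    case True
    then obtain P where P: "P \<subseteq> E \<inter> f -` {r}" "finite P" "card P = k" using many by force
    obtain e where e: "0 < e" "\<And>p q. p \<in> P \<Longrightarrow> q \<in> P \<Longrightarrow> dist p q < e \<Longrightarrow> p = q"
    proof -
      \<comment> \<open>The extra element 1 keeps \<open>Min D\<close> meaningful when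
        \<open>P\<close> has at most one point.\<close>
      define D where "D = insert 1 (case_prod dist ` {z \<in> P \<times> P. fst z \<noteq> snd z})"
      have "finite D" using P(2) by (simp add: D_def)
      moreover have "D \<noteq> {}" "\<forall>d\<in>D. 0 < d" by (auto simp: D_def)
      ultimately have "0 < Min D" by simp
      moreover have "p = q" if "p \<in> P" "q \<in> P" "dist p q < Min D" for p q
      proof (rule ccontr)
        assume "p \<noteq> q"
        with that have "dist p q \<in> D" by (force simp: D_def)
        with \<open>finite D\<close> that(3) show False by (simp add: leD)
      qed
      ultimately show ?thesis using that by blast
    qed
    obtain N where N: "1 / real (Suc N) < e" using nat_approx_posE[OF \<open>0 < e\<close>] by auto
    have "\<forall>\<^sub>F n in sequentially. of_nat k \<le> \<phi> n r"
    proof (rule eventually_sequentiallyI[of N])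
      fix n assume "N \<le> n"
      then have "1 / real (Suc n) \<le> 1 / real (Suc N)" by (simp add: field_simps)
      with N have n: "1 / real (Suc n) < e" by linarith
      have "\<exists>i. p \<in> C n i" if "p \<in> P" for p using P(1) C(3)[of n] that by auto
      then obtain j where j: "\<And>p. p \<in> P \<Longrightarrow> p \<in> C n (j p)" by metis
      \<comment> \<open>Once the diameters are below the smallest gap in \<open>P\<close>, no cover
        set contains two points of \<open>P\<close>, so at least \<open>k\<close> of the intervals
        contain \<open>r\<close>.\<close>
      have "inj_on j P"
      proof (rule inj_onI)
        fix p q assume pq: "p \<in> P" "q \<in> P" "j p = j q"
        have "dist p q \<le> diameter (C n (j p))"
          using j[OF pq(1)] j[OF pq(2)] pq(3) by (intro diameter_bounded_bound[OF C(1)]) auto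
        with C(2)[of n "j p"] n have "dist p q < e" by linarith
        with e(2) pq show "p = q" by auto
      qed
      have "(of_nat k :: ennreal) = (\<Sum>i\<in>j ` P. 1)"
        using P(3) card_image[OF \<open>inj_on j P\<close>] by simp
      also have "\<dots> \<le> (\<Sum>i\<in>j ` P. indicator (I n i) r)"
      proof (rule sum_mono)
        fix i assume "i \<in> j ` P"
        then obtain p where "p \<in> P" "i = j p" by auto
        then show "1 \<le> (indicator (I n i) r :: ennreal)"
          using memI[OF j[of p]] P(1) by (auto simp: indicator_def)
      qed
      also have "\<dots> \<le> \<phi> n r"
        unfolding \<phi>_def using P(2) by (intro sum_le_suminf) auto
      finally show "of_nat k \<le> \<phi> n r" .
    qed
    with True show ?thesis by (auto intro!: Liminf_bounded)
  qed simp
  have "ennreal (real k * (b - a)) = (\<integral>\<^sup>+ r. of_nat k * indicator {a<..<b} r \<partial>lborel)"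
    using \<open>a < b\<close> by (simp add: nn_integral_cmult_indicator ennreal_of_nat_eq_real_of_nat ennreal_mult)
  also have "\<dots> \<le> (\<integral>\<^sup>+ r. liminf (\<lambda>n. \<phi> n r) \<partial>lborel)"
    by (intro nn_integral_mono \<phi>_ge)
  also have "\<dots> \<le> liminf (\<lambda>n. \<integral>\<^sup>+ r. \<phi> n r \<partial>lborel)"
    by (rule nn_integral_liminf[OF \<phi>_meas])
  also have "\<dots> \<le> liminf (\<lambda>n. hausdorff1 E + ennreal (1 / Suc n))"
    by (intro Liminf_mono always_eventually allI \<phi>_int)
  also have "\<dots> = hausdorff1 E"
  proof (rule lim_imp_Liminf)
    have "(\<lambda>n. hausdorff1 E + ennreal (1 / Suc n)) \<longlonglongrightarrow> hausdorff1 E + ennreal 0"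
      by (intro tendsto_add tendsto_const tendsto_ennrealI LIMSEQ_Suc lim_1_over_n)
    then show "(\<lambda>n. hausdorff1 E + ennreal (1 / Suc n)) \<longlonglongrightarrow> hausdorff1 E" by simp
  qed simp
  finally show ?thesis .
qed simp

section \<open>Short connected sets through finitely many points of a sphere\<close>

lemma power_add_superadditive:
  fixes a b :: real
  assumes "0 \<le> a" "0 \<le> b"
  shows "a ^ Suc n + b ^ Suc n \<le> (a + b) ^ Suc n"
proof (induction n)
  case (Suc n)
  have "a ^ Suc (Suc n) + b ^ Suc (Suc n) \<le> (a + b) * (a ^ Suc n + b ^ Suc n)"
    using assms by (simp add: algebra_simps)
  also have "\<dots> \<le> (a + b) * (a + b) ^ Suc n"
    using Suc assms by (intro mult_left_mono) auto
  finally show ?case by simp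
qed simp

text \<open>Up to the volume of the unit ball, the left side is the volume of the shell between
  radii \<open>r - t\<close> and \<open>r + t\<close>. In the induction the sum of the two powers is
  at most a power of \<open>2 * r\<close> by superadditivity.\<close>

lemma power_diff_shell:
  fixes r t :: real
  assumes "0 \<le> t" "t \<le> r"
  shows "(r + t) ^ Suc n - (r - t) ^ Suc n \<le> 2 ^ Suc n * r ^ n * t"
proof (induction n)
  case (Suc n)
  have "(r + t) ^ Suc (Suc n) - (r - t) ^ Suc (Suc n)
      = r * ((r + t) ^ Suc n - (r - t) ^ Suc n) + t * ((r + t) ^ Suc n + (r - t) ^ Suc n)"
    by (simp add: algebra_simps)
  also have "\<dots> \<le> r * (2 ^ Suc n * r ^ n * t) + t * (2 * r) ^ Suc n"
    using Suc assms power_add_superadditive[of "r + t" "r - t" n]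
    by (intro add_mono mult_left_mono) auto
  also have "\<dots> = 2 ^ Suc (Suc n) * r ^ Suc n * t"
    by (simp add: power_mult_distrib algebra_simps)
  finally show ?case .
qed simp

lemma sphere_close_pair:
  fixes P :: "'a::euclidean_space set"
  assumes P: "finite P" "P \<subseteq> sphere x r" "2 \<le> card P" and dim: "DIM('a) = m + 2"
  obtains p q where "p \<in> P" "q \<in> P" "p \<noteq> q"
    "dist p q ^ (m + 1) * real (card P) \<le> 2 ^ (2 * m + 3) * r ^ (m + 1)"
proof -
  \<comment> \<open>Balls of half the minimal distance around the points are disjoint and lie in a thin shell;
    compare volumes.\<close>
  define D where "D = {z \<in> P \<times> P. fst z \<noteq> snd z}"
  have "finite D" using P by (auto simp: D_def)
  moreover have "D \<noteq> {}"
  proof -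
    obtain p q where "p \<in> P" "q \<in> P" "p \<noteq> q"
      using P(3) card_2_iff obtain_subset_with_card_n[of 2 P] by (metis insert_subset)
    then show ?thesis by (auto simp: D_def)
  qed
  ultimately obtain z where z: "z \<in> D" "\<And>w. w \<in> D \<Longrightarrow> dist (fst z) (snd z) \<le> dist (fst w) (snd w)"
    using arg_min_if_finite[of D "\<lambda>z. dist (fst z) (snd z)"] by (metis not_le)
  define p q t where "p = fst z" and "q = snd z" and "t = dist p q / 2"
  have pq: "p \<in> P" "q \<in> P" "p \<noteq> q" using z by (auto simp: D_def p_def q_def)
  have sep: "2 * t \<le> dist u v" if "u \<in> P" "v \<in> P" "u \<noteq> v" for u v
    using z(2)[of "(u,v)"] that by (auto simp: D_def t_def p_def q_def)
  have on: "dist x u = r" if "u \<in> P" for u using P that by auto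
  have "0 < t" using pq by (simp add: t_def)
  \<comment> \<open>Two points of the sphere are at most \<open>2 * r\<close> apart; hence the inner
    radius \<open>r - t\<close> is nonnegative, as the volume formula requires.\<close>
  have "t \<le> r" using on[OF pq(1)] on[OF pq(2)] dist_triangle3[of p q x] by (simp add: t_def)
  have "disjoint_family_on (\<lambda>u. ball u t) P"
    unfolding disjoint_family_on_def
  proof (intro ballI impI)
    fix u v assume uv: "u \<in> P" "v \<in> P" "u \<noteq> v"
    show "ball u t \<inter> ball v t = {}"
    proof (rule ccontr)
      assume "ball u t \<inter> ball v t \<noteq> {}"
      then obtain w where "dist u w < t" "dist v w < t" by auto
      with sep[OF uv] dist_triangle2[of u v w] show False by linarith
    qed
  qed
  then have U: "measure lborel (\<Union>u\<in>P. ball u t) = (\<Sum>u\<in>P. measure lborel (ball u t))"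
    using P(1) emeasure_lborel_ball_finite by (intro measure_finite_Union) (auto simp: less_top)
  have disj: "(\<Union>u\<in>P. ball u t) \<inter> ball x (r - t) = {}"
  proof (rule ccontr)
    assume "(\<Union>u\<in>P. ball u t) \<inter> ball x (r - t) \<noteq> {}"
    then obtain u w where "u \<in> P" "dist u w < t" "dist x w < r - t" by auto
    with on[of u] dist_triangle2[of x u w] show False by linarith
  qed
  have "(\<Union>u\<in>P. ball u t) \<in> sets lborel" by (auto intro!: borel_open)
  then have L: "measure lebesgue (\<Union>u\<in>P. ball u t) = (\<Sum>u\<in>P. measure lborel (ball u t))"
    using U by (simp only: measure_completion)
  have fm: "(\<Union>u\<in>P. ball u t) \<in> lmeasurable" "ball x (r - t) \<in> lmeasurable"
    using P(1) by (auto intro!: lmeasurable_open)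
  have sub: "(\<Union>u\<in>P. ball u t) \<union> ball x (r - t) \<subseteq> cball x (r + t)"
  proof
    fix w assume "w \<in> (\<Union>u\<in>P. ball u t) \<union> ball x (r - t)"
    then consider u where "u \<in> P" "dist u w < t" | "dist x w < r - t" by auto
    then have "dist x w \<le> r + t"
    proof cases
      case 1
      then show ?thesis using on[of u] dist_triangle[of x w u] by linarith
    qed (use \<open>0 < t\<close> in linarith)
    then show "w \<in> cball x (r + t)" by simp
  qed
  have "(\<Sum>u\<in>P. measure lborel (ball u t)) + measure lborel (ball x (r - t))
      = measure lebesgue ((\<Union>u\<in>P. ball u t) \<union> ball x (r - t))"
    using measure_Un3[OF fm] disj L by simp
  also have "\<dots> \<le> measure lebesgue (cball x (r + t))"
    using fm sub by (intro measure_mono_fmeasurable) auto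
  finally have "real (card P) * (unit_ball_vol (m + 2) * t ^ (m + 2))
      + unit_ball_vol (m + 2) * (r - t) ^ (m + 2) \<le> unit_ball_vol (m + 2) * (r + t) ^ (m + 2)"
    using \<open>0 < t\<close> \<open>t \<le> r\<close> by (simp add: content_ball content_cball dim measure_completion)
  then have "unit_ball_vol (m + 2) * (real (card P) * t ^ (m + 2))
      \<le> unit_ball_vol (m + 2) * ((r + t) ^ (m + 2) - (r - t) ^ (m + 2))"
    by (simp add: algebra_simps)
  then have "real (card P) * t ^ (m + 2) \<le> (r + t) ^ Suc (m + 1) - (r - t) ^ Suc (m + 1)"
    by (subst (asm) mult_le_cancel_left_pos) auto
  also have "\<dots> \<le> 2 ^ Suc (m + 1) * r ^ (m + 1) * t"
    using \<open>0 < t\<close> \<open>t \<le> r\<close> by (intro power_diff_shell) auto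
  \<comment> \<open>Cancelling one factor \<open>t\<close> lowers the exponent from the dimension
    \<open>m + 2\<close> of the space to the dimension \<open>m + 1\<close> of the sphere.\<close>
  finally have "(real (card P) * t ^ (m + 1)) * t \<le> (2 ^ Suc (m + 1) * r ^ (m + 1)) * t"
    by (simp add: algebra_simps)
  then have *: "real (card P) * t ^ (m + 1) \<le> 2 ^ Suc (m + 1) * r ^ (m + 1)"
    using \<open>0 < t\<close> mult_le_cancel_right_pos by blast
  have "dist p q ^ (m + 1) * real (card P) = 2 ^ (m + 1) * (real (card P) * t ^ (m + 1))"
    by (simp add: t_def power_divide)
  also have "\<dots> \<le> 2 ^ (m + 1) * (2 ^ Suc (m + 1) * r ^ (m + 1))"
    using * by (intro mult_left_mono) auto
  also have "2 ^ (m + 1) * (2 ^ Suc (m + 1) * r ^ (m + 1)) = 2 ^ ((m + 1) + Suc (m + 1)) * r ^ (m + 1)"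
    by (simp only: power_add mult.assoc)
  also have "(m + 1) + Suc (m + 1) = 2 * m + 3" by simp
  finally show ?thesis using that pq by blast
qed

text \<open>Tangent estimate at \<open>n\<close> for the concave power function, derived from
  Young's inequality with weights \<open>\<alpha>\<close> and \<open>1 - \<alpha>\<close>. It makes
  segment lengths of order \<open>n powr (\<alpha> - 1)\<close> add up to order
  \<open>n powr \<alpha>\<close>.\<close>

lemma powr_increment:
  fixes \<alpha> n :: real
  assumes "0 < \<alpha>" "\<alpha> < 1" "1 < n"
  shows "(n - 1) powr \<alpha> + \<alpha> * n powr (\<alpha> - 1) \<le> n powr \<alpha>"
proof -
  have "(n - 1) powr \<alpha> * n powr (1 - \<alpha>) \<le> \<alpha> * (n - 1) + (1 - \<alpha>) * n"
    using assms by (intro Youngs_inequality_0) auto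
  also have "\<dots> = n - \<alpha>" by (simp add: algebra_simps)
  finally have "(n - 1) powr \<alpha> * n powr (1 - \<alpha>) * n powr (\<alpha> - 1) \<le> (n - \<alpha>) * n powr (\<alpha> - 1)"
    by (intro mult_right_mono) auto
  moreover have "n powr (1 - \<alpha>) * n powr (\<alpha> - 1) = 1"
    using assms by (simp flip: powr_add)
  moreover have "n * n powr (\<alpha> - 1) = n powr \<alpha>"
    using assms by (simp add: powr_mult_base)
  ultimately show ?thesis by (simp add: left_diff_distrib mult.assoc)
qed

lemma powr_divide_power:
  fixes x c :: real
  assumes "0 < x"
  shows "(x powr (c / (real m + 1))) ^ (m + 1) = x powr c"
proof -
  have "(x powr (c / (real m + 1))) ^ (m + 1) = (x powr (c / (real m + 1))) powr real (m + 1)"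
    using assms by (intro powr_realpow[symmetric]) simp
  also have "\<dots> = x powr (c / (real m + 1) * real (m + 1))" by (rule powr_powr)
  also have "c / (real m + 1) * real (m + 1) = c" by (simp add: field_simps)
  finally show ?thesis .
qed

lemma sphere_connect_powr:
  fixes P :: "'a::euclidean_space set"
  assumes "finite P" "P \<noteq> {}" "P \<subseteq> sphere x r" and dim: "DIM('a) = m + 2" and "0 < m"
  shows "\<exists>T. connected T \<and> P \<subseteq> T \<and> hausdorff1 T \<le> ennreal
    (2 powr ((2 * real m + 3) / (real m + 1)) * r * ((real m + 1) / real m * real (card P) powr (real m / (real m + 1))))"
  using assms(1-3)
proof (induction "card P" arbitrary: P rule: less_induct)
  \<comment> \<open>Greedily join the closest pair and discard one of its points.\<close>
  case less
  define \<alpha> where "\<alpha> = real m / (real m + 1)"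
  define E where "E = 2 powr ((2 * real m + 3) / (real m + 1))"
  have \<alpha>: "0 < \<alpha>" "\<alpha> < 1" using \<open>0 < m\<close> by (auto simp: \<alpha>_def)
  have inv: "(real m + 1) / m = 1 / \<alpha>" by (simp add: \<alpha>_def)
  have "0 \<le> r" using less.prems by auto
  show ?case
  proof (cases "card P = 1")
    case True
    then obtain p where p: "P = {p}" using card_1_singletonE by blast
    have "hausdorff1 {p} \<le> 0" using hausdorff1_closed_segment[of p p] by simp
    then show ?thesis using p by (intro exI[of _ "{p}"]) auto
  next
    case False
    define N where "N = real (card P)"
    have "card P \<noteq> 0" using less.prems by simp
    with False have "2 \<le> card P" by linarith
    then have "2 \<le> N" by (simp add: N_def)
    obtain p q where pq: "p \<in> P" "q \<in> P" "p \<noteq> q"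
      "dist p q ^ (m + 1) * N \<le> 2 ^ (2 * m + 3) * r ^ (m + 1)"
      using sphere_close_pair[OF less.prems(1,3) \<open>2 \<le> card P\<close> dim] unfolding N_def by blast
    \<comment> \<open>This is the \<open>(m + 1)\<close>-st root of the bound on the closest pair,
      since \<open>\<alpha> - 1\<close> equals \<open>- 1 / (m + 1)\<close>.\<close>
    have "dist p q \<le> E * r * N powr (\<alpha> - 1)"
    proof -
      have E: "E ^ (m + 1) = 2 ^ (2 * m + 3)"
        unfolding E_def by (subst powr_divide_power) (auto simp flip: powr_realpow)
      have "\<alpha> - 1 = - 1 / (real m + 1)" by (simp add: \<alpha>_def field_simps)
      then have "(N powr (\<alpha> - 1)) ^ (m + 1) = N powr (- 1)"
        using \<open>2 \<le> N\<close> by (simp only: powr_divide_power)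
      also have "\<dots> = 1 / N" using \<open>2 \<le> N\<close> by (simp add: powr_minus_divide)
      finally have "(E * r * N powr (\<alpha> - 1)) ^ (m + 1) = 2 ^ (2 * m + 3) * r ^ (m + 1) * (1 / N)"
        unfolding power_mult_distrib E by simp
      moreover have "dist p q ^ (m + 1) \<le> 2 ^ (2 * m + 3) * r ^ (m + 1) * (1 / N)"
        using pq(4) \<open>2 \<le> N\<close> by (simp add: pos_le_divide_eq)
      ultimately have "dist p q ^ Suc m \<le> (E * r * N powr (\<alpha> - 1)) ^ Suc m" by simp
      moreover have "0 \<le> E * r * N powr (\<alpha> - 1)" using \<open>0 \<le> r\<close> by (simp add: E_def)
      ultimately show ?thesis by (rule power_le_imp_le_base)
    qed
    have cd: "card (P - {q}) < card P" "real (card (P - {q})) = N - 1"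
      using pq(2) less.prems(1) \<open>2 \<le> card P\<close> by (auto simp: N_def of_nat_diff)
    obtain T where T: "connected T" "P - {q} \<subseteq> T"
      "hausdorff1 T \<le> ennreal (E * r * (1 / \<alpha> * (N - 1) powr \<alpha>))"
      using less.hyps[OF cd(1)] less.prems pq unfolding cd(2) E_def[symmetric]
      by (auto simp: inv \<alpha>_def E_def add.commute)
    show ?thesis
    proof (intro exI[of _ "T \<union> closed_segment p q"] conjI)
      show "connected (T \<union> closed_segment p q)"
        using T(2) pq by (intro connected_Un T(1)) auto
      show "P \<subseteq> T \<union> closed_segment p q" using T(2) by auto
      have "hausdorff1 (T \<union> closed_segment p q) \<le> hausdorff1 T + hausdorff1 (closed_segment p q)"
        by (rule hausdorff1_Un)
      also have "\<dots> \<le> ennreal (E * r * (1 / \<alpha> * (N - 1) powr \<alpha>)) + ennreal (dist p q)"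
        by (intro add_mono T hausdorff1_closed_segment)
      also have "\<dots> \<le> ennreal (E * r * (1 / \<alpha> * (N - 1) powr \<alpha>)) + ennreal (E * r * N powr (\<alpha> - 1))"
        using \<open>dist p q \<le> _\<close> by (intro add_mono ennreal_leI) auto
      \<comment> \<open>The factor \<open>1 / \<alpha>\<close> in the claim is what allows
        \<open>powr_increment\<close> to absorb the new segment.\<close>
      also have "\<dots> = ennreal (E * r * (1 / \<alpha> * ((N - 1) powr \<alpha> + \<alpha> * N powr (\<alpha> - 1))))"
        using \<alpha> \<open>0 \<le> r\<close> by (subst ennreal_plus[symmetric]) (auto simp: E_def field_simps)
      also have "\<dots> \<le> ennreal (E * r * (1 / \<alpha> * N powr \<alpha>))"
        using \<alpha> \<open>0 \<le> r\<close> \<open>2 \<le> N\<close> powr_increment[of \<alpha> N]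
        by (intro ennreal_leI mult_left_mono) (auto simp: E_def)
      finally show "hausdorff1 (T \<union> closed_segment p q) \<le> ennreal
        (2 powr ((2 * real m + 3) / (real m + 1)) * r * ((real m + 1) / real m * real (card P) powr (real m / (real m + 1))))"
        by (simp add: E_def \<alpha>_def N_def add.commute)
    qed
  qed
qed

text \<open>Passing to the power \<open>m + 1\<close> removes the fractional exponents before the
  comparison with \<open>S\<close>. The case of empty \<open>P\<close> is included because the
  sphere may miss \<open>S\<close>; then \<open>T = {}\<close> serves.\<close>

lemma sphere_connect:
  fixes P :: "'a::euclidean_space set"
  assumes "finite P" "P \<subseteq> sphere x r" and dim: "DIM('a) = m + 2" and "0 < m" "0 \<le> r"
  shows "\<exists>T l. connected T \<and> P \<subseteq> T \<and> 0 \<le> l \<and> hausdorff1 T \<le> ennreal l \<and>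
    l ^ (m + 1) \<le> 2 ^ (2 * m + 3) * ((real m + 1) / real m) ^ (m + 1) * r ^ (m + 1) * real (card P) ^ m"
proof (cases "P = {}")
  case True
  with \<open>0 < m\<close> \<open>0 \<le> r\<close> show ?thesis by (intro exI[of _ "{}"] exI[of _ 0]) auto
next
  case False
  define N where "N = real (card P)"
  have "0 < N" using False assms by (auto simp: N_def card_gt_0_iff)
  define l where "l = 2 powr ((2 * real m + 3) / (real m + 1)) * r *
    ((real m + 1) / m * N powr (real m / (real m + 1)))"
  obtain T where T: "connected T" "P \<subseteq> T" "hausdorff1 T \<le> ennreal l"
    using sphere_connect_powr[OF assms(1) False assms(2) dim \<open>0 < m\<close>]
    by (auto simp: l_def N_def add.commute)
  have "(2 powr ((2 * real m + 3) / (real m + 1))) ^ (m + 1) = (2::real) ^ (2 * m + 3)"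
    by (subst powr_divide_power) (auto simp flip: powr_realpow)
  moreover have "(N powr (real m / (real m + 1))) ^ (m + 1) = N ^ m"
    using \<open>0 < N\<close> by (subst powr_divide_power) (auto simp: powr_realpow)
  ultimately have "l ^ (m + 1) = 2 ^ (2 * m + 3) * r ^ (m + 1) * (((real m + 1) / m) ^ (m + 1) * N ^ m)"
    unfolding l_def power_mult_distrib by simp
  then have "l ^ (m + 1) \<le> 2 ^ (2 * m + 3) * ((real m + 1) / real m) ^ (m + 1) * r ^ (m + 1) * N ^ m"
    by (simp add: ac_simps)
  moreover have "0 \<le> l" using \<open>0 \<le> r\<close> by (simp add: l_def)
  ultimately show ?thesis using T unfolding N_def by blast
qed

section \<open>A growth argument for monotone functions\<close>

text \<open>
  Discrete substitute for integrating \<open>f^((m+1)/m) \<le> D^(1/m) f'\<close>: along radii converging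
  geometrically to \<^term>\<open>s\<close> the value of \<^term>\<open>f\<close> at least doubles at each step, so it blows up
  before \<^term>\<open>s\<close> unless it starts small.
\<close>

lemma doubling_bound:
  fixes f :: "real \<Rightarrow> real"
  assumes "0 < m" "a < s" "0 \<le> D" "0 \<le> f a"
    and bdd: "\<And>t. a \<le> t \<Longrightarrow> t < s \<Longrightarrow> f t \<le> M"
    and mono: "\<And>t u. a \<le> t \<Longrightarrow> t \<le> u \<Longrightarrow> u < s \<Longrightarrow> f t \<le> f u"
    and step: "\<And>t u. a \<le> t \<Longrightarrow> t < u \<Longrightarrow> u < s \<Longrightarrow>
      f t ^ (m + 1) * (u - t) ^ m \<le> D * (f u - f t) ^ m"
  shows "f a * (s - a) ^ m \<le> D * (2 * real m) ^ m"
proof (cases "f a = 0")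
  case True
  with assms show ?thesis by simp
next
  case False
  define F where "F = f a"
  have "0 < F" using False assms by (simp add: F_def)
  show ?thesis
  proof (rule ccontr)
    assume "\<not> f a * (s - a) ^ m \<le> D * (2 * real m) ^ m"
    then have big: "D * (2 * real m) ^ m < F * (s - a) ^ m" by (simp add: F_def)
    \<comment> \<open>This is \<open>(s - a) * (1 - \<theta>)\<close> for the ratio
      \<open>\<theta>\<close> below, hence the first gap between the radii \<open>u k\<close>. The
      negated claim then reads \<open>D < F * L ^ m\<close>.\<close>
    define L where "L = (s - a) / (2 * real m)"
    have "0 < L" using assms by (simp add: L_def)
    have L: "D \<le> F * L ^ m"
    proof -
      have "0 < (2 * real m) ^ m" using \<open>0 < m\<close> by simp
      with big show ?thesis by (simp add: L_def power_divide pos_le_divide_eq)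
    qed
    \<comment> \<open>The ratio is chosen so that \<^term>\<open>2 * \<theta> ^ m\<close> is at least 1 (Bernoulli).\<close>
    define \<theta> where "\<theta> = 1 - 1 / (2 * real m)"
    have \<theta>: "0 < \<theta>" "\<theta> < 1" using \<open>0 < m\<close> by (auto simp: \<theta>_def field_simps)
    have "1 + real m * (- 1 / (2 * real m)) \<le> (1 + (- 1 / (2 * real m))) ^ m"
      using \<open>0 < m\<close> by (intro Bernoulli_inequality) (auto simp: field_simps)
    then have \<theta>m: "1 \<le> 2 * \<theta> ^ m" using \<open>0 < m\<close> by (simp add: \<theta>_def)
    define u where "u = (\<lambda>k. s - (s - a) * \<theta> ^ k)"
    have u: "a \<le> u k" "u k < u (Suc k)" "u k < s" "u (Suc k) - u k = L * \<theta> ^ k" for k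
    proof -
      have "0 < \<theta> ^ k" "\<theta> ^ k \<le> 1" using \<theta> by (auto intro: power_le_one)
      then show "u k < s" "a \<le> u k" using \<open>a < s\<close> mult_left_le[OF \<open>\<theta> ^ k \<le> 1\<close>, of "s - a"]
        unfolding u_def by (simp, linarith)
      have "u (Suc k) - u k = (s - a) * (1 - \<theta>) * \<theta> ^ k" by (simp add: u_def algebra_simps)
      also have "(s - a) * (1 - \<theta>) = L" by (simp add: \<theta>_def L_def)
      finally show "u (Suc k) - u k = L * \<theta> ^ k" .
      moreover have "0 < L * \<theta> ^ k" using \<open>0 < L\<close> \<theta> by simp
      ultimately show "u k < u (Suc k)" by linarith
    qed
    have grow: "2 ^ k * F \<le> f (u k)" for k
    proof (induction k)
      case 0
      then show ?case by (simp add: u_def F_def)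
    next
      case (Suc k)
      define g where "g = f (u k)"
      define \<Delta> where "\<Delta> = f (u (Suc k)) - g"
      have "0 < 2 ^ k * F" using \<open>0 < F\<close> by simp
      then have "0 < g" using Suc by (simp add: g_def)
      have "0 \<le> \<Delta>" using mono[of "u k" "u (Suc k)"] u[of k] u[of "Suc k"] by (simp add: \<Delta>_def g_def)
      \<comment> \<open>The growth \<open>2 ^ k\<close> of \<open>f\<close> compensates for the
        shrinking of the gaps by \<open>\<theta> ^ k\<close>, taken to the power
        \<open>m\<close>.\<close>
      have "1 \<le> (2 * \<theta> ^ m) ^ k" using \<theta>m by (rule one_le_power)
      then have "F \<le> F * (2 * \<theta> ^ m) ^ k" using \<open>0 < F\<close> by simp
      also have "\<dots> = (2 ^ k * F) * (\<theta> ^ k) ^ m"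
        by (simp add: power_mult_distrib power_mult[symmetric] mult.commute)
      also have "\<dots> \<le> g * (\<theta> ^ k) ^ m"
        using Suc \<theta> by (intro mult_right_mono) (auto simp: g_def)
      \<comment> \<open>The factor \<open>L ^ m * g ^ m\<close> produces the left side of
        \<open>step\<close>. Afterwards \<open>F * L ^ m\<close> cancels, leaving
        \<open>g \<le> \<Delta>\<close>, which is the doubling.\<close>
      finally have "F * (L ^ m * g ^ m) \<le> g * (\<theta> ^ k) ^ m * (L ^ m * g ^ m)"
        using \<open>0 < L\<close> \<open>0 < g\<close> by (intro mult_right_mono) auto
      also have "\<dots> = g ^ (m + 1) * (L * \<theta> ^ k) ^ m" by (simp add: power_mult_distrib)
      also have "\<dots> \<le> D * \<Delta> ^ m"
        using step[of "u k" "u (Suc k)"] u[of k] u[of "Suc k"] by (simp add: g_def \<Delta>_def)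
      also have "\<dots> \<le> F * L ^ m * \<Delta> ^ m"
        using L \<open>0 \<le> \<Delta>\<close> by (intro mult_right_mono) auto
      finally have "(F * L ^ m) * g ^ m \<le> (F * L ^ m) * \<Delta> ^ m" by (simp add: mult.assoc)
      moreover have "0 < F * L ^ m" using \<open>0 < F\<close> \<open>0 < L\<close> by simp
      ultimately have "g ^ m \<le> \<Delta> ^ m" by (simp only: mult_le_cancel_left_pos)
      then have "g \<le> \<Delta>" using \<open>0 < m\<close> \<open>0 \<le> \<Delta>\<close> power_mono_iff[of g \<Delta> m] \<open>0 < g\<close> by simp
      then show ?case using Suc by (simp add: g_def \<Delta>_def)
    qed
    obtain k where "M / F < 2 ^ k" using real_arch_pow[of 2 "M / F"] by auto
    then have "M < 2 ^ k * F" using \<open>0 < F\<close> by (simp add: field_simps)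
    with grow[of k] bdd[of "u k"] u[of k] show False by linarith
  qed
qed

section \<open>Length of a Steiner set in balls away from \<open>A\<close>\<close>

text \<open>The competitor is \<open>S - ball x r \<union> T\<close>. Removing the ball leaves
  \<open>A\<close> intact, so minimality applies. The outer part has finite measure and cancels; the
  distance \<open>r - a\<close> makes the measures of the outer and inner parts add up.\<close>

lemma steiner_ball_le:
  fixes A S :: "'a::metric_space set"
  assumes "steiner_set A S" "hausdorff1 S < \<infinity>" "A \<inter> ball x r = {}" "a < r"
    and T: "connected T" "(S \<union> A) \<inter> sphere x r \<subseteq> T"
  shows "hausdorff1 (S \<inter> ball x a) \<le> hausdorff1 T"
proof (cases "S \<inter> ball x a = {}")
  case False
  have "(S \<union> A) \<inter> ball x r \<noteq> {}" using False \<open>a < r\<close> by force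
  then have "connected ((S \<union> A) - ball x r \<union> T)"
    using assms by (intro connected_replace_ball) (auto simp: steiner_set_def)
  moreover have "(S \<union> A) - ball x r \<union> T = (S - ball x r \<union> T) \<union> A" using assms(3) by auto
  ultimately have "hausdorff1 S \<le> hausdorff1 (S - ball x r \<union> T)"
    using assms(1) by (simp add: steiner_set_def)
  also have "\<dots> \<le> hausdorff1 (S - ball x r) + hausdorff1 T" by (rule hausdorff1_Un)
  finally have 1: "hausdorff1 S \<le> hausdorff1 (S - ball x r) + hausdorff1 T" .
  have "hausdorff1 (S - ball x r) + hausdorff1 (S \<inter> ball x a)
      \<le> hausdorff1 ((S - ball x r) \<union> (S \<inter> ball x a))"
  proof (rule hausdorff1_separated[of "r - a"])
    fix p q assume "p \<in> S - ball x r" "q \<in> S \<inter> ball x a"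
    then show "r - a \<le> dist p q" using dist_triangle[of x p q] by (simp add: dist_commute)
  qed (use \<open>a < r\<close> in simp)
  also have "\<dots> \<le> hausdorff1 S" by (intro hausdorff1_mono) auto
  finally have "hausdorff1 (S - ball x r) + hausdorff1 (S \<inter> ball x a)
      \<le> hausdorff1 (S - ball x r) + hausdorff1 T" using 1 by (rule order_trans)
  moreover have "hausdorff1 (S - ball x r) < top"
    using hausdorff1_mono[of "S - ball x r" S] assms(2) by (auto simp: less_top top_unique)
  ultimately show ?thesis by (auto simp: ennreal_add_left_cancel_le)
qed simp

text \<open>
  The gap between \<^term>\<open>a\<close> and \<^term>\<open>a'\<close> keeps the pieces of \<^term>\<open>S\<close> at positive distance, so that
  additivity of the Hausdorff measure needs no measurability; it is closed by a limit afterwards.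
\<close>

lemma steiner_ball_step_aux:
  fixes A S :: "'a::euclidean_space set"
  assumes dim: "DIM('a) = m + 2" "0 < m" and S: "steiner_set A S" "hausdorff1 S < \<infinity>"
    and A: "ball x s \<inter> A = {}" and "0 < a" "a < a'" "a' < b" "b < s"
  defines "f \<equiv> \<lambda>t. enn2real (hausdorff1 (S \<inter> ball x t))"
  shows "f a ^ (m + 1) * (b - a') ^ m
    \<le> 2 ^ (2 * m + 3) * ((real m + 1) / real m) ^ (m + 1) * s ^ (m + 1) * (f b - f a) ^ m"
proof -
  have fin: "hausdorff1 (S \<inter> U) < top" for U
    using hausdorff1_mono[of "S \<inter> U" S] S(2) by (auto simp: less_top top_unique)
  have f: "ennreal (f t) = hausdorff1 (S \<inter> ball x t)" for t
    using fin by (simp add: f_def)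
  define E where "E = S \<inter> (ball x b - ball x a')"
  have "hausdorff1 E + hausdorff1 (S \<inter> ball x a) \<le> hausdorff1 (E \<union> (S \<inter> ball x a))"
  proof (rule hausdorff1_separated[of "a' - a"])
    fix p q assume "p \<in> E" "q \<in> S \<inter> ball x a"
    then show "a' - a \<le> dist p q"
      using dist_triangle[of x p q] by (simp add: E_def dist_commute)
  qed (use \<open>a < a'\<close> in simp)
  also have "\<dots> \<le> hausdorff1 (S \<inter> ball x b)"
    using \<open>a < a'\<close> \<open>a' < b\<close> by (intro hausdorff1_mono) (auto simp: E_def)
  finally have "ennreal (enn2real (hausdorff1 E)) + ennreal (f a) \<le> ennreal (f b)"
    using fin by (simp add: f E_def)
  then have Ele: "enn2real (hausdorff1 E) \<le> f b - f a"
    by (subst (asm) ennreal_plus[symmetric])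
      (auto simp: f_def ennreal_le_iff simp flip: ennreal_plus)
  define h where "h = enn2real (hausdorff1 E) / (b - a')"
  have "0 \<le> h" using \<open>a' < b\<close> by (simp add: h_def)
  \<comment> \<open>The least natural number above \<open>h\<close>, so that fewer than
    \<open>k\<close> points means at most \<open>h\<close> points.\<close>
  define k where "k = nat \<lfloor>h\<rfloor> + 1"
  have "h < real k" using \<open>0 \<le> h\<close> by (simp add: k_def) linarith
  \<comment> \<open>If every sphere carried \<open>k\<close> points of \<open>E\<close>, slicing
    would give \<open>E\<close> measure at least \<open>k * (b - a')\<close>, which exceeds
    \<open>h * (b - a')\<close>, its actual measure.\<close>
  have "\<exists>r. a' < r \<and> r < b \<and> \<not> (\<exists>P. P \<subseteq> E \<inter> dist x -` {r} \<and> finite P \<and> card P = k)"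
  proof (rule ccontr)
    assume "\<not> ?thesis"
    then have "ennreal (real k * (b - a')) \<le> hausdorff1 E"
      using \<open>a' < b\<close> abs_dist_diff_le[of _ x]
      by (intro hausdorff1_slices[of "dist x"]) (auto simp: dist_commute)
    also have "\<dots> = ennreal (enn2real (hausdorff1 E))" using fin by (simp add: E_def)
    finally have "real k * (b - a') \<le> enn2real (hausdorff1 E)" by simp
    with \<open>h < real k\<close> \<open>a' < b\<close> show False by (simp add: h_def field_simps)
  qed
  then obtain r where r: "a' < r" "r < b" "\<nexists>P. P \<subseteq> E \<inter> dist x -` {r} \<and> finite P \<and> card P = k" by blast
  define P where "P = (S \<union> A) \<inter> sphere x r"
  have P: "P = E \<inter> dist x -` {r}"
  proof -
    have "p \<notin> A" if "dist x p = r" for p using A r(2) \<open>b < s\<close> that by (auto simp: disjoint_iff)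
    then show ?thesis using r(1,2) by (auto simp: P_def E_def)
  qed
  \<comment> \<open>An infinite slice would contain a subset of exactly \<open>k\<close> points, and
    so would one with at least \<open>k\<close> points.\<close>
  have "finite P" using r(3) infinite_arbitrarily_large[of P k] unfolding P by blast
  have "card P < k"
  proof (rule ccontr)
    assume "\<not> card P < k"
    then show False using obtain_subset_with_card_n[of k P] r(3) unfolding P by (metis not_less)
  qed
  then have "real (card P) \<le> h" using \<open>0 \<le> h\<close> by (simp add: k_def) linarith
  then have "real (card P) * (b - a') \<le> enn2real (hausdorff1 E)"
    using \<open>a' < b\<close> by (simp add: h_def field_simps)
  with Ele have N: "real (card P) * (b - a') \<le> f b - f a" by linarith
  have "0 < r" using r \<open>0 < a\<close> \<open>a < a'\<close> by linarith
  obtain T l where T: "connected T" "P \<subseteq> T" "0 \<le> l" "hausdorff1 T \<le> ennreal l"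
    "l ^ (m + 1) \<le> 2 ^ (2 * m + 3) * ((real m + 1) / real m) ^ (m + 1) * r ^ (m + 1) * real (card P) ^ m"
    using sphere_connect[OF \<open>finite P\<close> _ dim, of x r] \<open>0 < r\<close> by (auto simp: P_def)
  have "hausdorff1 (S \<inter> ball x a) \<le> hausdorff1 T"
    using S A r \<open>a < a'\<close> \<open>b < s\<close> T(1,2)
    by (intro steiner_ball_le[where A = A and r = r]) (auto simp: P_def disjoint_iff)
  with T(4) have "ennreal (f a) \<le> ennreal l" using f by auto
  then have "f a \<le> l" using T(3) by simp
  define D where "D = 2 ^ (2 * m + 3) * ((real m + 1) / real m) ^ (m + 1)"
  have "0 \<le> D" by (simp add: D_def)
  have "0 \<le> f a" by (simp add: f_def)
  then have "f a ^ (m + 1) \<le> l ^ (m + 1)" using \<open>f a \<le> l\<close> by (intro power_mono) auto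
  also have "\<dots> \<le> D * r ^ (m + 1) * real (card P) ^ m" using T(5) by (simp add: D_def)
  also have "\<dots> \<le> D * s ^ (m + 1) * real (card P) ^ m"
    using \<open>0 \<le> D\<close> \<open>0 < r\<close> \<open>r < b\<close> \<open>b < s\<close>
    by (intro mult_right_mono mult_left_mono power_mono) auto
  finally have "f a ^ (m + 1) * (b - a') ^ m \<le> D * s ^ (m + 1) * real (card P) ^ m * (b - a') ^ m"
    using \<open>a' < b\<close> by (intro mult_right_mono) auto
  also have "\<dots> = D * s ^ (m + 1) * (real (card P) * (b - a')) ^ m"
    by (simp add: power_mult_distrib)
  also have "\<dots> \<le> D * s ^ (m + 1) * (f b - f a) ^ m"
    using N \<open>0 \<le> D\<close> \<open>a' < b\<close> \<open>0 < r\<close> \<open>r < b\<close> \<open>b < s\<close>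
    by (intro mult_left_mono power_mono) auto
  finally show ?thesis by (simp add: D_def)
qed

text \<open>Let \<open>a'\<close> decrease to \<open>a\<close> in
  \<open>steiner_ball_step_aux\<close>; only the continuous factor \<open>(b - a') ^ m\<close>
  depends on it.\<close>

lemma steiner_ball_step:
  fixes A S :: "'a::euclidean_space set"
  assumes "DIM('a) = m + 2" "0 < m" "steiner_set A S" "hausdorff1 S < \<infinity>"
    and "ball x s \<inter> A = {}" "0 < a" "a < b" "b < s"
  defines "f \<equiv> \<lambda>t. enn2real (hausdorff1 (S \<inter> ball x t))"
  shows "f a ^ (m + 1) * (b - a) ^ m
    \<le> 2 ^ (2 * m + 3) * ((real m + 1) / real m) ^ (m + 1) * s ^ (m + 1) * (f b - f a) ^ m"
proof (rule tendsto_upperbound[where F = "at_right a"])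
  show "((\<lambda>a'. f a ^ (m + 1) * (b - a') ^ m) \<longlongrightarrow> f a ^ (m + 1) * (b - a) ^ m) (at_right a)"
    by (intro tendsto_intros)
  show "\<forall>\<^sub>F a' in at_right a. f a ^ (m + 1) * (b - a') ^ m
    \<le> 2 ^ (2 * m + 3) * ((real m + 1) / real m) ^ (m + 1) * s ^ (m + 1) * (f b - f a) ^ m"
    using steiner_ball_step_aux[OF assms(1-6) _ _ \<open>b < s\<close>] \<open>a < b\<close>
    unfolding eventually_at_right[OF \<open>a < b\<close>] f_def by blast
qed simp

lemma steiner_ball_bound:
  fixes A S :: "'a::euclidean_space set"
  assumes dim: "DIM('a) = m + 2" "0 < m" and S: "steiner_set A S" "hausdorff1 S < \<infinity>"
    and A: "ball x s \<inter> A = {}" and "0 < s" "0 < \<rho>" "\<rho> < 1"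
  shows "hausdorff1 (S \<inter> ball x (\<rho> * s)) \<le> ennreal (s * (144 * (real m + 2) / (1 - \<rho>)) ^ m)"
proof -
  define f where "f = (\<lambda>t. enn2real (hausdorff1 (S \<inter> ball x t)))"
  define M where "M = real m"
  have "1 \<le> M" using \<open>0 < m\<close> by (simp add: M_def)
  have fin: "hausdorff1 (S \<inter> U) < top" for U
    using hausdorff1_mono[of "S \<inter> U" S] S(2) by (auto simp: less_top top_unique)
  have mono: "f t \<le> f u" if "t \<le> u" for t u
    unfolding f_def using that fin
    by (intro enn2real_mono hausdorff1_mono) auto
  have "f (\<rho> * s) * (s - \<rho> * s) ^ m
      \<le> (2 ^ (2 * m + 3) * ((M + 1) / M) ^ (m + 1) * s ^ (m + 1)) * (2 * M) ^ m"
    unfolding M_def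
  proof (rule doubling_bound)
    show "f t ^ (m + 1) * (u - t) ^ m
      \<le> (2 ^ (2 * m + 3) * ((real m + 1) / real m) ^ (m + 1) * s ^ (m + 1)) * (f u - f t) ^ m"
      if "\<rho> * s \<le> t" "t < u" "u < s" for t u
    proof -
      have "0 < \<rho> * s" using assms by simp
      then show ?thesis
        using steiner_ball_step[OF dim S A _ that(2,3)] that(1) by (simp add: f_def add.commute)
    qed
    \<comment> \<open>The upper bound that \<open>doubling_bound\<close> asks for is
      \<open>f s\<close>; monotonicity of the real-valued \<open>f\<close> rests on the finite
      measure of \<open>S\<close>.\<close>
    show "f t \<le> f s" if "t < s" for t using mono that by simp
    show "0 \<le> f (\<rho> * s)" by (simp add: f_def)
  qed (use assms mono in auto)
  \<comment> \<open>As \<open>2 ^ (2 * m + 3)\<close> is \<open>8 * 4 ^ m\<close>, the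
    \<open>m\<close>-th powers combine to \<open>(8 * (M + 1)) ^ m\<close>, and 8 and one factor
    \<open>(M + 1) / M\<close> are left over.\<close>
  also have "\<dots> = s ^ (m + 1) * ((8 * (M + 1)) ^ m * (8 * ((M + 1) / M)))"
  proof -
    have "8 * (M + 1) = 4 * ((M + 1) / M) * (2 * M)" using \<open>1 \<le> M\<close> by simp
    then have "(8 * (M + 1)) ^ m = 4 ^ m * ((M + 1) / M) ^ m * (2 * M) ^ m"
      by (simp only: power_mult_distrib)
    moreover have "(2::real) ^ (2 * m + 3) = 4 ^ m * 8" by (simp add: power_add power_mult)
    ultimately show ?thesis by simp
  qed
  also have "\<dots> \<le> s ^ (m + 1) * (144 * (M + 2)) ^ m"
  proof (intro mult_left_mono)
    \<comment> \<open>The leftover factor is at most 16, hence at most \<open>16 ^ m\<close>, and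
      \<open>8 * 16 = 128\<close> is below 144.\<close>
    have "8 * ((M + 1) / M) \<le> 16" using \<open>1 \<le> M\<close> by (simp add: field_simps)
    also have "(16::real) \<le> 16 ^ m" using \<open>0 < m\<close> by (intro self_le_power) auto
    finally have "(8 * (M + 1)) ^ m * (8 * ((M + 1) / M)) \<le> (8 * (M + 1)) ^ m * 16 ^ m"
      using \<open>1 \<le> M\<close> by (intro mult_left_mono) auto
    also have "\<dots> = (128 * (M + 1)) ^ m" by (simp flip: power_mult_distrib)
    also have "\<dots> \<le> (144 * (M + 2)) ^ m" using \<open>1 \<le> M\<close> by (intro power_mono) auto
    finally show "(8 * (M + 1)) ^ m * (8 * ((M + 1) / M)) \<le> (144 * (M + 2)) ^ m" .
  qed (use \<open>0 < s\<close> in auto)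
  finally have "f (\<rho> * s) * (s - \<rho> * s) ^ m \<le> s ^ (m + 1) * (144 * (M + 2)) ^ m" .
  moreover have "(s - \<rho> * s) ^ m = s ^ m * (1 - \<rho>) ^ m"
    by (simp add: power_mult_distrib[symmetric] algebra_simps)
  ultimately have "s ^ m * (f (\<rho> * s) * (1 - \<rho>) ^ m) \<le> s ^ m * (s * (144 * (M + 2)) ^ m)"
    by (simp add: algebra_simps)
  then have "f (\<rho> * s) * (1 - \<rho>) ^ m \<le> s * (144 * (M + 2)) ^ m"
    using \<open>0 < s\<close> by (subst (asm) mult_le_cancel_left_pos) auto
  then have "f (\<rho> * s) \<le> s * (144 * (M + 2) / (1 - \<rho>)) ^ m"
    using \<open>\<rho> < 1\<close> by (simp add: power_divide pos_le_divide_eq)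
  then show ?thesis
    using fin[of "ball x (\<rho> * s)"] by (simp add: f_def M_def ennreal_leI enn2real_le)
qed

theorem theorem2:
  fixes A S :: "(real ^ 'd) set" and x :: "real ^ 'd" and s \<rho> :: real
  assumes "CARD('d) > 2"
    and "compact A"
    and "steiner_tree A S"
    and "hausdorff1 S < \<infinity>"
    and "s > 0"
    and "ball x s \<inter> A = {}"
    and "0 < \<rho>" and "\<rho> < 1"
  shows "hausdorff1 (S \<inter> ball x (\<rho> * s)) / ennreal s
           \<le> ennreal ((144 * real CARD('d) / (1 - \<rho>)) ^ (CARD('d) - 2))"
proof -
  define m where "m = CARD('d) - 2"
  have m: "CARD('d) = m + 2" "0 < m" using assms(1) by (auto simp: m_def)
  have "hausdorff1 (S \<inter> ball x (\<rho> * s)) \<le> ennreal (s * (144 * (real m + 2) / (1 - \<rho>)) ^ m)"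
    using assms(3-8) m by (intro steiner_ball_bound[where A = A]) (auto simp: steiner_tree_def)
  then have "hausdorff1 (S \<inter> ball x (\<rho> * s)) / ennreal s
      \<le> ennreal (s * (144 * (real m + 2) / (1 - \<rho>)) ^ m) / ennreal s"
    by (rule divide_right_mono_ennreal)
  also have "\<dots> = ennreal ((144 * (real m + 2) / (1 - \<rho>)) ^ m)"
    using assms(5,8) by (subst divide_ennreal) auto
  finally show ?thesis by (simp add: m add.commute)
qed

end
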